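(* Let $\mathcal A=\{w_1,\dots,w_n\}\subset\mathbb Z^d$ be a point configuration, let $\Gamma$ be a regular full-dimensional pure simplicial complex supported on $\mathcal A$, i.e. a pure $d$-dimensional subcomplex of a regular triangulation of $\mathcal A$, and let $\phi:\mathcal A\to\mathbb R^d$ be a map. Then there is a choice of real coefficients, which can be constructed from the map $\phi$, that produces a sparse polynomial system $$f_1(X_1,\dots,X_d)=\cdots=f_d(X_1,\dots,X_d)=0$$ supported on $\mathcal A$ whose number of non-degenerate positive solutions is bounded below by the number of facets of $\Gamma$ which are positively decorated by $\phi$.
   Context: A triangulation of $\mathcal A$ is a triangulation of $\mathrm{conv}(\mathcal A)$ with vertices in $\mathcal A$. It is regular if there is a convex function on $\mathrm{conv}(\mathcal A)$ that is affine on each simplex of the triangulation but not affine on the union of two different facets ($d$-simplices). A facet $\tau=\mathrm{conv}(w_{i_1},\dots,w_{i_{d+1}})$ of $\Gamma$ is positively decorated by $\phi$ if $\phi(w_{i_1}),\dots,\phi(w_{i_{d+1}})$ positively span $\mathbb R^d$, i.e. every vector of $\mathbb R^d$ is a linear combination of them with positive coefficients. A system with real coefficients is supported on $\mathcal A$ if every exponent vector $w\in\mathbb Z^d$ of a monomial $X^w=X_1^{w^{(1)}}\cdots X_d^{w^{(d)}}$ appearing with a nonzero coefficient in at least one equation belongs to $\mathcal A$; the coefficients of the monomial $X^{w_i}$ are obtained from $\phi(w_i)$. A positive solution is a solution in $\mathbb R_{>0}^d$; it is non-degenerate if the Jacobian matrix of the system is invertible at it. *)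

theory Defs
  imports "HOL-Analysis.Analysis" "HOL-Library.Poly_Mapping"
begin

section \<open>Regular triangulations of lattice point configurations\<close>

definition lattice_vec :: "int^'d \<Rightarrow> real^'d" where
  "lattice_vec w = (\<chi> i. real_of_int (w $ i))"

definition affine_fun_on :: "(real^'d) set \<Rightarrow> (real^'d \<Rightarrow> real) \<Rightarrow> bool" where
  "affine_fun_on S h \<longleftrightarrow> (\<exists>a b. \<forall>x\<in>S. h x = a \<bullet> x + b)"

text \<open>Facets are the simplices of the ambient dimension.\<close>

definition facets :: "(real^'d) set set \<Rightarrow> (real^'d) set set" where
  "facets \<Gamma> = {\<tau> \<in> \<Gamma>. int CARD('d) simplex \<tau>}"

text \<open>Not every point of \<open>A\<close> has to be used as a vertex.\<close>

definition triangulation_of :: "(int^'d) set \<Rightarrow> (real^'d) set set \<Rightarrow> bool" where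
  "triangulation_of A T \<longleftrightarrow>
     simplicial_complex T \<and>
     \<Union>T = convex hull (lattice_vec ` A) \<and>
     (\<forall>S\<in>T. \<forall>v. v extreme_point_of S \<longrightarrow> v \<in> lattice_vec ` A)"

text \<open>The union of two facets need not be convex; \<^const>\<open>affine_fun_on\<close> asks for a single
  affine function that agrees with \<open>h\<close> on all of it.\<close>

definition regular_triangulation_of :: "(int^'d) set \<Rightarrow> (real^'d) set set \<Rightarrow> bool" where
  "regular_triangulation_of A T \<longleftrightarrow>
     triangulation_of A T \<and>
     (\<exists>h. convex_on (convex hull (lattice_vec ` A)) h \<and>
          (\<forall>S\<in>T. affine_fun_on S h) \<and>
          (\<forall>\<sigma>\<in>facets T. \<forall>\<tau>\<in>facets T. \<sigma> \<noteq> \<tau> \<longrightarrow> \<not> affine_fun_on (\<sigma> \<union> \<tau>) h))"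

definition regular_full_dim_pure_complex :: "(int^'d) set \<Rightarrow> (real^'d) set set \<Rightarrow> bool" where
  "regular_full_dim_pure_complex A \<Gamma> \<longleftrightarrow>
     (\<exists>T. regular_triangulation_of A T \<and> \<Gamma> \<subseteq> T) \<and>
     simplicial_complex \<Gamma> \<and>
     (\<forall>S\<in>\<Gamma>. \<exists>\<tau>\<in>facets \<Gamma>. S face_of \<tau>)"


section \<open>Positively decorated facets\<close>

text \<open>The combinations are indexed by \<open>V\<close>, not by its image, since \<open>\<phi>\<close> need not be injective.\<close>

definition positively_spans :: "(int^'d \<Rightarrow> real^'d) \<Rightarrow> (int^'d) set \<Rightarrow> bool" where
  "positively_spans \<phi> V \<longleftrightarrow>
     (\<forall>y. \<exists>c. (\<forall>w\<in>V. c w > 0) \<and> y = (\<Sum>w\<in>V. c w *\<^sub>R \<phi> w))"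

definition positively_decorated :: "(int^'d \<Rightarrow> real^'d) \<Rightarrow> (real^'d) set \<Rightarrow> bool" where
  "positively_decorated \<phi> \<tau> \<longleftrightarrow>
     positively_spans \<phi> {w. lattice_vec w extreme_point_of \<tau>}"


section \<open>Sparse systems and their non-degenerate positive solutions\<close>

text \<open>Exponents may be negative, so these are Laurent polynomials, given by their finitely
  supported coefficient functions.\<close>

type_synonym 'd laurent_system = "((int^'d) \<Rightarrow>\<^sub>0 real)^'d"

definition laurent_eval :: "((int^'d) \<Rightarrow>\<^sub>0 real) \<Rightarrow> real^'d \<Rightarrow> real" where
  "laurent_eval p x =
     (\<Sum>w\<in>Poly_Mapping.keys p. Poly_Mapping.lookup p w * (\<Prod>i\<in>UNIV. (x $ i) powi (w $ i)))"

definition system_eval :: "'d laurent_system \<Rightarrow> real^'d \<Rightarrow> real^'d" where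
  "system_eval F x = (\<chi> j. laurent_eval (F $ j) x)"

definition supported_on :: "'d laurent_system \<Rightarrow> (int^'d) set \<Rightarrow> bool" where
  "supported_on F A \<longleftrightarrow> (\<forall>j. Poly_Mapping.keys (F $ j) \<subseteq> A)"

definition coeff_vec :: "'d laurent_system \<Rightarrow> int^'d \<Rightarrow> real^'d" where
  "coeff_vec F w = (\<chi> j. Poly_Mapping.lookup (F $ j) w)"

definition nondegenerate_positive_solutions :: "'d laurent_system \<Rightarrow> (real^'d) set" where
  "nondegenerate_positive_solutions F =
     {x. (\<forall>i. x $ i > 0) \<and> system_eval F x = 0 \<and> invertible (jacobian (system_eval F) (at x))}"

text \<open>The coefficients are constructed from \<open>\<phi>\<close> by positive rescaling: the coefficients of the
  monomial with exponent \<open>w\<close> in the \<open>d\<close> equations form a positive multiple of \<open>\<phi> w\<close>, as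
  \<open>t powr h w *\<^sub>R \<phi> w\<close> does for a height function \<open>h\<close> and \<open>t > 0\<close>.\<close>

definition coeffs_rescale :: "'d laurent_system \<Rightarrow> (int^'d) set \<Rightarrow> (int^'d \<Rightarrow> real^'d) \<Rightarrow> bool" where
  "coeffs_rescale F A \<phi> \<longleftrightarrow> (\<forall>w\<in>A. \<exists>s>0. coeff_vec F w = s *\<^sub>R \<phi> w)"

text \<open>Numbers of elements are compared with \<open>\<lesssim>\<close> rather than \<^const>\<open>card\<close>, which would
  presuppose that the solution set is finite.\<close>

end

theory Submission
  imports Defs
begin

text \<open>This is Viro's method in logarithmic coordinates. With coefficients \<open>exp (- s * H w) *\<^sub>R \<phi> w\<close>,
  where \<open>H\<close> lifts the vertices to the graph of the convex function, substituting
  \<open>z = u + s *\<^sub>R a\<close>, with \<open>a\<close> the slope of the lifted facet \<open>\<tau>\<close>, turns the system, up to a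
  positive factor, into the one restricted to the vertices of \<open>\<tau>\<close> plus terms that vanish as \<open>s\<close> tends to infinity. The restricted system has a
  non-degenerate zero if \<open>\<tau>\<close> is positively decorated, and this zero persists for large \<open>s\<close>. Distinct facets
  have distinct slopes, so the zeros of different facets drift apart.\<close>

section \<open>Non-degenerate zeros of exponential sums\<close>

text \<open>This is a Laurent system after the substitution \<open>x = exp u\<close>:
  \<open>e\<close> holds the exponents, \<open>\<phi>\<close> the coefficient vectors. The scalars
  \<open>c\<close> are kept apart because translating \<open>u\<close> or rescaling the system
  changes only them.\<close>

definition exponential_sum :: "'i set \<Rightarrow> ('i \<Rightarrow> real) \<Rightarrow> ('i \<Rightarrow> 'a::euclidean_space) \<Rightarrow> ('i \<Rightarrow> 'a) \<Rightarrow> 'a \<Rightarrow> 'a"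
  where "exponential_sum I c e \<phi> u = (\<Sum>i\<in>I. (c i * exp (e i \<bullet> u)) *\<^sub>R \<phi> i)"

definition exponential_sum_deriv ::
    "'i set \<Rightarrow> ('i \<Rightarrow> real) \<Rightarrow> ('i \<Rightarrow> 'a::euclidean_space) \<Rightarrow> ('i \<Rightarrow> 'a) \<Rightarrow> 'a \<Rightarrow> 'a \<Rightarrow> 'a"
  where "exponential_sum_deriv I c e \<phi> u v = (\<Sum>i\<in>I. (c i * exp (e i \<bullet> u) * (e i \<bullet> v)) *\<^sub>R \<phi> i)"

lemma exponential_sum_has_derivative:
  "(exponential_sum I c e \<phi> has_derivative exponential_sum_deriv I c e \<phi> u) (at u within S)"
proof -
  have "((\<lambda>u. \<Sum>i\<in>I. (c i * exp (e i \<bullet> u)) *\<^sub>R \<phi> i) has_derivative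
         (\<lambda>v. \<Sum>i\<in>I. (c i * exp (e i \<bullet> u) * (e i \<bullet> v)) *\<^sub>R \<phi> i)) (at u within S)"
    by (auto intro!: derivative_eq_intros sum.cong simp: algebra_simps)
  then show ?thesis
    by (simp add: exponential_sum_def[abs_def] exponential_sum_deriv_def[abs_def])
qed

lemma linear_exponential_sum_deriv: "linear (exponential_sum_deriv I c e \<phi> u)"
  using exponential_sum_has_derivative has_derivative_linear by blast

text \<open>This rule lets the shift by the slope of a lifted facet be absorbed into the scalars, so
  that all facets can be treated near bounded points.\<close>

lemma exponential_sum_add: "exponential_sum I c e \<phi> (u + z) = exponential_sum I (\<lambda>i. c i * exp (e i \<bullet> z)) e \<phi> u"
  by (simp add: exponential_sum_def inner_add_right exp_add mult_ac)

lemma exponential_sum_deriv_add: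
  "exponential_sum_deriv I c e \<phi> (u + z) = exponential_sum_deriv I (\<lambda>i. c i * exp (e i \<bullet> z)) e \<phi> u"
  by (rule ext) (simp add: exponential_sum_deriv_def inner_add_right exp_add mult_ac)

lemma exponential_sum_scale: "exponential_sum I (\<lambda>i. k * c i) e \<phi> u = k *\<^sub>R exponential_sum I c e \<phi> u"
  by (simp add: exponential_sum_def scaleR_sum_right mult_ac)

lemma exponential_sum_deriv_scale:
  "exponential_sum_deriv I (\<lambda>i. k * c i) e \<phi> u v = k *\<^sub>R exponential_sum_deriv I c e \<phi> u v"
  by (simp add: exponential_sum_deriv_def scaleR_sum_right mult_ac)

text \<open>The zero is the fixed point of the simplified Newton map \<open>u - L (G u)\<close>, where \<open>G\<close> is the
  perturbed sum and \<open>L\<close> inverts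
  the derivative at the unperturbed zero; it is a contraction by one half near that zero.\<close>

lemma exponential_sum_zero_persists:
  fixes u0 :: "'a::euclidean_space"
  assumes c: "\<And>i. i \<in> I \<Longrightarrow> ((\<lambda>s. c s i) \<longlongrightarrow> c0 i) \<F>"
    and zero: "exponential_sum I c0 e \<phi> u0 = 0"
    and surj: "surj (exponential_sum_deriv I c0 e \<phi> u0)"
    and "r > 0"
  shows "\<forall>\<^sub>F s in \<F>. \<exists>u\<in>cball u0 r. exponential_sum I (c s) e \<phi> u = 0 \<and> inj (exponential_sum_deriv I (c s) e \<phi> u)"
proof -
  let ?D0 = "exponential_sum_deriv I c0 e \<phi> u0"
  have "inj ?D0"
    using linear_surj_imp_inj[OF linear_exponential_sum_deriv surj] .
  then obtain L where L: "linear L" "\<And>v. L (?D0 v) = v"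
    using linear_injective_left_inverse[OF linear_exponential_sum_deriv] by (metis comp_def id_apply)
  \<comment> \<open>\<open>L\<close> was chosen as a left inverse; surjectivity makes it a right
    inverse too, which later turns \<open>L y = 0\<close> into \<open>y = 0\<close>.\<close>
  have surjD0: "?D0 (L y) = y" for y
  proof -
    obtain v where "y = ?D0 v"
      using surj by (rule surjE)
    then show ?thesis
      by (simp only: L(2))
  qed
  obtain B where B: "B > 0" "\<And>y. norm (L y) \<le> B * norm y"
    using linear_bounded_pos[OF L(1)] by blast
  \<comment> \<open>\<open>K s u\<close> bounds the operator norm of the derivative of the Newton
    map at \<open>u\<close>. Its summands vanish once scalars and exponentials take their limit
    values.\<close>
  define K where "K s u = B * (\<Sum>i\<in>I. \<bar>c0 i * exp (e i \<bullet> u0) - c s i * exp (e i \<bullet> u)\<bar> * norm (e i) * norm (\<phi> i))"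
    for s u
  have K: "norm (v - L (exponential_sum_deriv I (c s) e \<phi> u v)) \<le> K s u * norm v" for s u v
  proof -
    let ?\<Delta> = "?D0 v - exponential_sum_deriv I (c s) e \<phi> u v"
    have \<Delta>: "?\<Delta> = (\<Sum>i\<in>I. ((c0 i * exp (e i \<bullet> u0) - c s i * exp (e i \<bullet> u)) * (e i \<bullet> v)) *\<^sub>R \<phi> i)"
      by (simp add: exponential_sum_deriv_def sum_subtractf[symmetric] algebra_simps)
    have "norm ?\<Delta> \<le> (\<Sum>i\<in>I. \<bar>c0 i * exp (e i \<bullet> u0) - c s i * exp (e i \<bullet> u)\<bar> * norm (e i) * norm (\<phi> i) * norm v)"
      unfolding \<Delta>
    proof (rule sum_norm_le)
      fix i
      have "\<bar>e i \<bullet> v\<bar> \<le> norm (e i) * norm v"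
        by (rule Cauchy_Schwarz_ineq2)
      then have "\<bar>c0 i * exp (e i \<bullet> u0) - c s i * exp (e i \<bullet> u)\<bar> * \<bar>e i \<bullet> v\<bar> * norm (\<phi> i)
          \<le> \<bar>c0 i * exp (e i \<bullet> u0) - c s i * exp (e i \<bullet> u)\<bar> * (norm (e i) * norm v) * norm (\<phi> i)"
        by (intro mult_right_mono mult_left_mono) auto
      then show "norm (((c0 i * exp (e i \<bullet> u0) - c s i * exp (e i \<bullet> u)) * (e i \<bullet> v)) *\<^sub>R \<phi> i)
          \<le> \<bar>c0 i * exp (e i \<bullet> u0) - c s i * exp (e i \<bullet> u)\<bar> * norm (e i) * norm (\<phi> i) * norm v"
        by (simp add: abs_mult mult_ac)
    qed
    then have "B * norm ?\<Delta> \<le> B * (\<Sum>i\<in>I. \<bar>c0 i * exp (e i \<bullet> u0) - c s i * exp (e i \<bullet> u)\<bar> * norm (e i) * norm (\<phi> i) * norm v)"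
      using B(1) by (intro mult_left_mono) auto
    moreover have "v - L (exponential_sum_deriv I (c s) e \<phi> u v) = L ?\<Delta>"
      by (simp only: L(2) linear_diff[OF L(1)])
    moreover note B(2)[of ?\<Delta>]
    ultimately have "norm (v - L (exponential_sum_deriv I (c s) e \<phi> u v)) \<le>
        B * (\<Sum>i\<in>I. \<bar>c0 i * exp (e i \<bullet> u0) - c s i * exp (e i \<bullet> u)\<bar> * norm (e i) * norm (\<phi> i) * norm v)"
      by (simp only: order_trans)
    then show ?thesis
      by (simp add: K_def sum_distrib_left sum_distrib_right mult_ac)
  qed
  have fst_lim: "((\<lambda>x. c (fst x) i) \<longlongrightarrow> c0 i) (\<F> \<times>\<^sub>F nhds u0)" if "i \<in> I" for i
    by (rule filterlim_compose[OF c[OF that] filterlim_fst])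
  \<comment> \<open>In the product filter, parameter and point vary together, so the bound on
    \<open>K\<close> holds on one neighbourhood of \<open>u0\<close> that does not depend on
    \<open>s\<close>.\<close>
  have "((\<lambda>x. K (fst x) (snd x)) \<longlongrightarrow>
        B * (\<Sum>i\<in>I. \<bar>c0 i * exp (e i \<bullet> u0) - c0 i * exp (e i \<bullet> u0)\<bar> * norm (e i) * norm (\<phi> i)))
        (\<F> \<times>\<^sub>F nhds u0)"
    unfolding K_def
    by (intro tendsto_intros fst_lim filterlim_snd)
  then have "((\<lambda>x. K (fst x) (snd x)) \<longlongrightarrow> 0) (\<F> \<times>\<^sub>F nhds u0)"
    by simp
  then have "\<forall>\<^sub>F x in \<F> \<times>\<^sub>F nhds u0. K (fst x) (snd x) < 1/2"
    by (rule order_tendstoD) simp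
  then obtain P Q where P: "eventually P \<F>" and Q: "eventually Q (nhds u0)"
    and PQ: "\<And>s u. P s \<Longrightarrow> Q u \<Longrightarrow> K s u < 1/2"
    unfolding eventually_prod_filter by auto
  obtain \<delta> where \<delta>: "\<delta> > 0" "\<And>u. dist u u0 < \<delta> \<Longrightarrow> Q u"
    using Q unfolding eventually_nhds_metric by blast
  \<comment> \<open>Halving \<delta> puts the closed ball inside the open one on which
    \<open>K\<close> is small.\<close>
  define \<rho> where "\<rho> = min r (\<delta>/2)"
  have \<rho>: "\<rho> > 0" "\<rho> \<le> r" "\<And>u. u \<in> cball u0 \<rho> \<Longrightarrow> Q u"
    using \<open>r > 0\<close> \<delta> by (auto simp: \<rho>_def dist_commute min_def split: if_splits)
  \<comment> \<open>This is the displacement of \<open>u0\<close> under the Newton map. Below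
    \<rho>/2, and with contraction factor 1/2, it makes the ball of radius \<rho> invariant.\<close>
  have "((\<lambda>s. norm (L (exponential_sum I (c s) e \<phi> u0))) \<longlongrightarrow> norm (L (exponential_sum I c0 e \<phi> u0))) \<F>"
    unfolding exponential_sum_def
    by (intro tendsto_intros c bounded_linear.tendsto[OF linear_conv_bounded_linear[THEN iffD1, OF L(1)]])
  then have "((\<lambda>s. norm (L (exponential_sum I (c s) e \<phi> u0))) \<longlongrightarrow> 0) \<F>"
    by (simp add: zero L linear_0)
  then have small: "\<forall>\<^sub>F s in \<F>. norm (L (exponential_sum I (c s) e \<phi> u0)) < \<rho>/2"
    by (rule order_tendstoD) (use \<rho> in simp)
  show ?thesis
    using P small
  proof eventually_elim
    case (elim s)
    define N where "N u = u - L (exponential_sum I (c s) e \<phi> u)" for u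
    have half: "norm (v - L (exponential_sum_deriv I (c s) e \<phi> u v)) \<le> (1/2) * norm v" if "u \<in> cball u0 \<rho>" for u v
      using K[of v s u] mult_right_mono[OF less_imp_le[OF PQ[OF elim(1) \<rho>(3)[OF that]]] norm_ge_zero[of v]]
      by (rule order_trans)
    have derN: "(N has_derivative (\<lambda>v. v - L (exponential_sum_deriv I (c s) e \<phi> u v))) (at u within cball u0 \<rho>)" for u
      unfolding N_def
      by (intro has_derivative_diff has_derivative_ident exponential_sum_has_derivative
          bounded_linear.has_derivative[OF linear_conv_bounded_linear[THEN iffD1, OF L(1)]])
    have lip: "norm (N x - N y) \<le> (1/2) * norm (x - y)" if "x \<in> cball u0 \<rho>" "y \<in> cball u0 \<rho>" for x y
      by (rule differentiable_bound[OF convex_cball derN onorm_le[OF half]]) (use that in auto)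
    have maps: "N x \<in> cball u0 \<rho>" if "x \<in> cball u0 \<rho>" for x
    proof -
      have "norm (N x - u0) \<le> norm (N x - N u0) + norm (N u0 - u0)"
        using norm_triangle_ineq[of "N x - N u0" "N u0 - u0"] by simp
      also have "\<dots> \<le> (1/2) * norm (x - u0) + \<rho>/2"
        using lip[OF that, of u0] elim(2) \<rho>(1) by (simp add: N_def)
      also have "\<dots> \<le> \<rho>"
        using that by (simp add: dist_norm norm_minus_commute)
      finally show ?thesis
        by (simp add: dist_norm norm_minus_commute)
    qed
    have "\<exists>!x. x \<in> cball u0 \<rho> \<and> N x = x"
      by (rule Banach_fix[where c = "1/2"])
        (use \<rho>(1) maps lip in \<open>auto simp: dist_norm complete_eq_closed\<close>)
    then obtain u where u: "u \<in> cball u0 \<rho>" "N u = u"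
      by blast
    have "L (exponential_sum I (c s) e \<phi> u) = 0"
      using u(2) by (simp add: N_def)
    then have "exponential_sum I (c s) e \<phi> u = 0"
      using surjD0 linear_0[OF linear_exponential_sum_deriv] by metis
    \<comment> \<open>If the derivative annihilates \<open>v\<close>, then \<open>half\<close> says
      that the norm of \<open>v\<close> is at most half of itself.\<close>
    moreover have "inj (exponential_sum_deriv I (c s) e \<phi> u)"
    proof (subst linear_injective_0[OF linear_exponential_sum_deriv], intro allI impI)
      fix v assume "exponential_sum_deriv I (c s) e \<phi> u v = 0"
      then show "v = 0"
        using half[OF u(1), of v] by (simp add: L linear_0)
    qed
    ultimately show ?case
      using u(1) \<rho>(2) by (meson mem_cball order_trans)
  qed
qed

text \<open>With a point \<open>p\<close> of \<open>C\<close> moved to the origin, the other points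
  become linearly independent, so some linear functional \<open>g\<close> takes any prescribed
  values there. Its adjoint at 1 is the gradient \<open>a\<close>, and \<open>b\<close> is fitted at
  \<open>p\<close>.\<close>

lemma affine_interpolation:
  fixes C :: "'a::euclidean_space set" and f :: "'a \<Rightarrow> real"
  assumes "\<not> affine_dependent C"
  obtains a b where "\<And>x. x \<in> C \<Longrightarrow> f x = a \<bullet> x + b"
proof (cases "C = {}")
  case False
  then obtain p where p: "p \<in> C" by blast
  then have "independent ((\<lambda>x. - p + x) ` (C - {p}))"
    using assms affine_dependent_iff_dependent2 by blast
  then obtain g where g: "linear g" "\<And>x. x \<in> C - {p} \<Longrightarrow> g (- p + x) = f x - f p"
    using linear_independent_extend[where f = "\<lambda>y. f (p + y) - f p"] by fastforce
  have "f x = adjoint g 1 \<bullet> x + (f p - adjoint g 1 \<bullet> p)" if "x \<in> C" for x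
  proof -
    have "g (- p + x) = f x - f p"
      using g that linear_0 by (cases "x = p") auto
    moreover have "g (- p + x) = adjoint g 1 \<bullet> (- p + x)"
      using adjoint_works[OF g(1), of "- p + x" 1] by (simp add: inner_commute)
    ultimately show ?thesis
      by (simp add: inner_diff_right)
  qed
  then show ?thesis
    by (rule that)
qed (use that in auto)

text \<open>Positive spanning yields a positive relation among the \<open>\<phi> i\<close>; interpolating the logarithms
  of its coefficients by an affine function gives the zero, and interpolation once more gives
  surjectivity of the derivative.\<close>

lemma exponential_sum_simplex_zero:
  fixes e :: "'i \<Rightarrow> 'a::euclidean_space"
  assumes indep: "\<not> affine_dependent (e ` V)" and inj: "inj_on e V"
    and span: "\<And>y. \<exists>c. (\<forall>i\<in>V. c i > 0) \<and> y = (\<Sum>i\<in>V. c i *\<^sub>R \<phi> i)"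
  obtains u where "exponential_sum V (\<lambda>_. 1) e \<phi> u = 0" "surj (exponential_sum_deriv V (\<lambda>_. 1) e \<phi> u)"
proof -
  have interpol: "\<exists>a b. \<forall>i\<in>V. f i = e i \<bullet> a + b" for f
  proof -
    obtain a b where "\<And>x. x \<in> e ` V \<Longrightarrow> f (the_inv_into V e x) = a \<bullet> x + b"
      using affine_interpolation[OF indep, of "\<lambda>x. f (the_inv_into V e x)"] by blast
    then have "f i = e i \<bullet> a + b" if "i \<in> V" for i
      using the_inv_into_f_f[OF inj that] that by (metis imageI inner_commute)
    then show ?thesis by blast
  qed
  obtain c where c: "\<And>i. i \<in> V \<Longrightarrow> c i > 0" "(\<Sum>i\<in>V. c i *\<^sub>R \<phi> i) = 0"
    using span[of 0] by metis
  obtain u \<beta> where u: "\<And>i. i \<in> V \<Longrightarrow> ln (c i) = e i \<bullet> u + \<beta>"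
    using interpol[of "\<lambda>i. ln (c i)"] by blast
  \<comment> \<open>The intercept \<beta> contributes one common factor to all terms and so does not
    affect being a zero.\<close>
  have c_eq: "exp (e i \<bullet> u) = exp (- \<beta>) * c i" if "i \<in> V" for i
  proof -
    have "e i \<bullet> u = - \<beta> + ln (c i)"
      using u[OF that] by simp
    then show ?thesis
      using c(1)[OF that] by (simp only: exp_add exp_ln)
  qed
  have zero: "exponential_sum V (\<lambda>_. 1) e \<phi> u = 0"
  proof -
    have "exponential_sum V (\<lambda>_. 1) e \<phi> u = exp (- \<beta>) *\<^sub>R (\<Sum>i\<in>V. c i *\<^sub>R \<phi> i)"
      by (simp add: exponential_sum_def scaleR_sum_right c_eq)
    then show ?thesis
      by (simp add: c(2))
  qed
  have "\<exists>v. y = exponential_sum_deriv V (\<lambda>_. 1) e \<phi> u v" for y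
  proof -
    obtain k where k: "y = (\<Sum>i\<in>V. k i *\<^sub>R \<phi> i)"
      using span[of y] by blast
    \<comment> \<open>The division anticipates the weight \<open>exp (e i \<bullet> u)\<close> in
      the derivative. The intercept \<gamma> then contributes a multiple of the sum at
      \<open>u\<close>, which is zero.\<close>
    obtain v \<gamma> where v: "\<And>i. i \<in> V \<Longrightarrow> k i / exp (e i \<bullet> u) = e i \<bullet> v + \<gamma>"
      using interpol[of "\<lambda>i. k i / exp (e i \<bullet> u)"] by blast
    have "y = (\<Sum>i\<in>V. (exp (e i \<bullet> u) * (e i \<bullet> v) + \<gamma> * exp (e i \<bullet> u)) *\<^sub>R \<phi> i)"
      unfolding k
    proof (rule sum.cong)
      fix i assume "i \<in> V"
      then have "k i = exp (e i \<bullet> u) * (e i \<bullet> v + \<gamma>)"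
        using v by (metis exp_not_eq_zero nonzero_mult_div_cancel_left times_divide_eq_right)
      then show "k i *\<^sub>R \<phi> i = (exp (e i \<bullet> u) * (e i \<bullet> v) + \<gamma> * exp (e i \<bullet> u)) *\<^sub>R \<phi> i"
        by (simp add: algebra_simps)
    qed simp
    also have "\<dots> = exponential_sum_deriv V (\<lambda>_. 1) e \<phi> u v + \<gamma> *\<^sub>R exponential_sum V (\<lambda>_. 1) e \<phi> u"
      by (simp add: exponential_sum_deriv_def exponential_sum_def scaleR_sum_right sum.distrib scaleR_add_left)
    finally show ?thesis
      using zero by auto
  qed
  then show ?thesis
    using that zero by (metis surj_def)
qed

section \<open>Strict convexity at the facets of a regular triangulation\<close>

text \<open>A short step from an interior point \<open>p\<close> of \<tau> towards \<open>x\<close>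
  stays in \<tau>, where \<open>h\<close> is affine; convexity along the segment then keeps
  \<open>h x\<close> from falling below the extension.\<close>

lemma convex_on_ge_affine_extension:
  fixes h :: "'a::euclidean_space \<Rightarrow> real"
  assumes conv: "convex_on S h" and "\<tau> \<subseteq> S" and "interior \<tau> \<noteq> {}"
    and eq: "\<And>x. x \<in> \<tau> \<Longrightarrow> h x = a \<bullet> x + b" and "x \<in> S"
  shows "a \<bullet> x + b \<le> h x"
proof -
  obtain p where p: "p \<in> interior \<tau>"
    using assms(3) by blast
  have "((\<lambda>t. (1 - t) *\<^sub>R p + t *\<^sub>R x) \<longlongrightarrow> (1 - 0) *\<^sub>R p + 0 *\<^sub>R x) (at_right (0::real))"
    by (intro tendsto_intros)
  then have "\<forall>\<^sub>F t in at_right (0::real). (1 - t) *\<^sub>R p + t *\<^sub>R x \<in> interior \<tau>"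
    using p by (intro topological_tendstoD) auto
  moreover have "\<forall>\<^sub>F t in at_right (0::real). t < 1"
    by (rule order_tendstoD(2)[OF tendsto_ident_at]) simp
  ultimately have "\<forall>\<^sub>F t in at_right (0::real). (1 - t) *\<^sub>R p + t *\<^sub>R x \<in> interior \<tau> \<and> 0 < t \<and> t < 1"
    using eventually_at_right_less[of 0] by eventually_elim auto
  then obtain t where t: "(1 - t) *\<^sub>R p + t *\<^sub>R x \<in> \<tau>" "0 < t" "t < 1"
    using eventually_happens[of _ "at_right (0::real)"] interior_subset[of \<tau>] by fastforce
  have "p \<in> \<tau>" "p \<in> S"
    using p interior_subset \<open>\<tau> \<subseteq> S\<close> by auto
  have "a \<bullet> ((1 - t) *\<^sub>R p + t *\<^sub>R x) + b = h ((1 - t) *\<^sub>R p + t *\<^sub>R x)"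
    using eq t by simp
  also have "\<dots> \<le> (1 - t) * h p + t * h x"
    using conv t \<open>p \<in> S\<close> \<open>x \<in> S\<close> by (simp add: convex_on_def)
  also have "h p = a \<bullet> p + b"
    using eq \<open>p \<in> \<tau>\<close> by simp
  finally have "t * (a \<bullet> x + b) \<le> t * h x"
    by (simp add: inner_add_right algebra_simps)
  then show ?thesis
    using t by simp
qed

text \<open>If \<open>h\<close> touched the supporting affine function at a point \<open>x\<close> outside \<open>\<tau>\<close>, it would be affine on
  the hull of \<open>\<tau>\<close> and \<open>x\<close>, and a second facet would have to overlap that hull in a set of positive
  measure.\<close>

lemma regular_facet_strict:
  fixes h :: "real^'d \<Rightarrow> real"
  assumes "finite T" and simp: "\<And>S. S \<in> T \<Longrightarrow> \<exists>n. n simplex S"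
    and conv: "convex_on (\<Union>T) h"
    and affine: "\<And>S. S \<in> T \<Longrightarrow> affine_fun_on S h"
    and separate: "\<And>\<sigma>. \<sigma> \<in> facets T \<Longrightarrow> \<sigma> \<noteq> \<tau> \<Longrightarrow> \<not> affine_fun_on (\<tau> \<union> \<sigma>) h"
    and "\<tau> \<in> T" and "interior \<tau> \<noteq> {}"
    and eq: "\<And>x. x \<in> \<tau> \<Longrightarrow> h x = a \<bullet> x + b" and "x \<in> \<Union>T" "x \<notin> \<tau>"
  shows "a \<bullet> x + b < h x"
proof (rule ccontr)
  assume "\<not> a \<bullet> x + b < h x"
  then have hx: "h x \<le> a \<bullet> x + b" by simp
  have sub: "\<tau> \<subseteq> \<Union>T" using \<open>\<tau> \<in> T\<close> by blast
  have ge: "a \<bullet> y + b \<le> h y" if "y \<in> \<Union>T" for y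
    using convex_on_ge_affine_extension[OF conv sub \<open>interior \<tau> \<noteq> {}\<close> eq that] .
  \<comment> \<open>\<open>M\<close> is the contact set of \<open>h\<close> with the affine
    function. It is convex, since \<open>ge\<close> gives one inequality and convexity of
    \<open>h\<close> the other.\<close>
  define M where "M = {y \<in> \<Union>T. h y = a \<bullet> y + b}"
  have convT: "convex (\<Union>T)"
    using conv by (simp add: convex_on_def)
  have "convex M"
    unfolding convex_def
  proof (intro ballI allI impI)
    fix y z and u v :: real
    assume yz: "y \<in> M" "z \<in> M" and uv: "0 \<le> u" "0 \<le> v" "u + v = 1"
    let ?w = "u *\<^sub>R y + v *\<^sub>R z"
    have wT: "?w \<in> \<Union>T"
      using convT yz uv unfolding M_def convex_def by blast
    have "h ?w \<le> u * h y + v * h z"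
      using conv yz uv unfolding M_def convex_on_def by blast
    also have "\<dots> = a \<bullet> ?w + (u + v) * b"
      using yz by (simp add: M_def inner_add_right algebra_simps)
    finally show "?w \<in> M"
      using ge[OF wT] wT uv by (simp add: M_def)
  qed
  moreover have "insert x \<tau> \<subseteq> M"
    using eq ge hx \<open>x \<in> \<Union>T\<close> sub by (auto simp: M_def intro: antisym)
  ultimately have hull: "convex hull (insert x \<tau>) \<subseteq> M"
    by (simp add: hull_minimal)
  obtain n where n: "n simplex \<tau>"
    using simp \<open>\<tau> \<in> T\<close> by blast
  define U where "U = interior (convex hull (insert x \<tau>)) - \<tau>"
  have "open U"
    unfolding U_def using closed_simplex[OF n] by (intro open_Diff) auto
  have "U \<noteq> {}"
  proof -
    have "\<tau> \<subseteq> convex hull (insert x \<tau>)"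
      using hull_subset[of "insert x \<tau>" convex] by blast
    then obtain p where p: "p \<in> interior (convex hull (insert x \<tau>))"
      using \<open>interior \<tau> \<noteq> {}\<close> interior_mono by blast
    \<comment> \<open>Going from \<open>x\<close> towards \<open>p\<close>, every \<open>t\<close>
      strictly between 0 and 1 gives an interior point of the hull, and small \<open>t\<close> avoid
      the closed set \<tau>.\<close>
    have "((\<lambda>t. x - t *\<^sub>R (x - p)) \<longlongrightarrow> x - 0 *\<^sub>R (x - p)) (at_right (0::real))"
      by (intro tendsto_intros)
    then have "\<forall>\<^sub>F t in at_right (0::real). x - t *\<^sub>R (x - p) \<in> - \<tau>"
      using \<open>x \<notin> \<tau>\<close> closed_simplex[OF n] by (intro topological_tendstoD) auto
    moreover have "\<forall>\<^sub>F t in at_right (0::real). t < 1"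
      by (rule order_tendstoD(2)[OF tendsto_ident_at]) simp
    ultimately have "\<forall>\<^sub>F t in at_right (0::real). x - t *\<^sub>R (x - p) \<in> - \<tau> \<and> 0 < t \<and> t < 1"
      using eventually_at_right_less[of 0] by eventually_elim auto
    then obtain t where t: "x - t *\<^sub>R (x - p) \<notin> \<tau>" "0 < t" "t < 1"
      using eventually_happens[of _ "at_right (0::real)"] by fastforce
    have "x - t *\<^sub>R (x - p) \<in> interior (convex hull (insert x \<tau>))"
      using p t by (intro mem_interior_convex_shrink) (auto intro: hull_inc)
    then show ?thesis
      using t by (auto simp: U_def)
  qed
  have UM: "U \<subseteq> M"
    using hull interior_subset[of "convex hull (insert x \<tau>)"] by (auto simp: U_def)
  have U_eq: "U = \<Union>((\<lambda>\<sigma>. U \<inter> \<sigma>) ` T)"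
    using UM by (auto simp: M_def)
  \<comment> \<open>A nonempty open set is not negligible and \<open>T\<close> is finite, so some
    member meets \<open>U\<close> in a non-negligible set. Such a member has interior and is
    therefore a facet.\<close>
  have "\<not> negligible (\<Union>((\<lambda>\<sigma>. U \<inter> \<sigma>) ` T))"
    using open_not_negligible[OF \<open>open U\<close> \<open>U \<noteq> {}\<close>] by (simp only: U_eq[symmetric] not_False_eq_True)
  then obtain \<sigma> where \<sigma>: "\<sigma> \<in> T" "\<not> negligible (U \<inter> \<sigma>)"
    using \<open>finite T\<close> negligible_Union[of "(\<lambda>\<sigma>. U \<inter> \<sigma>) ` T"] by blast
  obtain m where m: "m simplex \<sigma>"
    using simp \<sigma> by blast
  have "\<not> negligible \<sigma>"
    using \<sigma>(2) negligible_subset by blast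
  then have "interior \<sigma> \<noteq> {}"
    using negligible_convex_interior convex_simplex[OF m] by blast
  then have "m = int CARD('d)"
    using aff_dim_nonempty_interior[of \<sigma>] aff_dim_simplex[OF m] by simp
  then have facet: "\<sigma> \<in> facets T"
    using m \<sigma>(1) by (simp add: facets_def)
  obtain a' b' where ab': "\<And>y. y \<in> \<sigma> \<Longrightarrow> h y = a' \<bullet> y + b'"
    using affine[OF \<sigma>(1)] unfolding affine_fun_on_def by blast
  \<comment> \<open>Both affine functions equal \<open>h\<close> on this set. If they differed, it
    would be empty or lie in a hyperplane, hence be negligible.\<close>
  have "U \<inter> \<sigma> \<subseteq> {y. (a' - a) \<bullet> y = b - b'}"
    using UM ab' by (fastforce simp: M_def inner_diff_left)
  then have "a' = a \<and> b' = b"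
    using \<sigma>(2) negligible_hyperplane[of "a' - a" "b - b'"] negligible_subset by (metis right_minus_eq)
  then have "affine_fun_on (\<tau> \<union> \<sigma>) h"
    using ab' eq unfolding affine_fun_on_def by blast
  moreover have "U \<inter> \<tau> = {}"
    by (auto simp: U_def)
  then have "\<sigma> \<noteq> \<tau>"
    using \<sigma>(2) by auto
  ultimately show False
    using separate facet by blast
qed

lemma facet_cases:
  fixes \<tau> :: "(real^'d) set"
  assumes "\<tau> \<in> facets T"
  obtains C where "{v. v extreme_point_of \<tau>} = C" "\<not> affine_dependent C" "interior \<tau> \<noteq> {}"
proof -
  obtain C where C: "finite C" "\<not> affine_dependent C" "int (card C) = int CARD('d) + 1"
      "\<tau> = convex hull C"
    using assms unfolding facets_def simplex by auto
  have "interior \<tau> \<noteq> {}"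
    using interior_convex_hull_eq_empty[of C] C by simp
  moreover have "{v. v extreme_point_of \<tau>} = C"
    using C extreme_point_of_convex_hull_affine_independent by auto
  ultimately show ?thesis
    using that C by blast
qed

text \<open>Points of \<open>A\<close> that are not vertices of the triangulation may lie on the graph of the affine
  pieces, so they are lifted strictly above \<open>h\<close>.\<close>

lemma regular_triangulation_heights:
  fixes A :: "(int^'d) set"
  assumes "regular_triangulation_of A T"
  obtains H a b where
    "\<And>\<tau> w. \<tau> \<in> facets T \<Longrightarrow> lattice_vec w extreme_point_of \<tau> \<Longrightarrow> H w = lattice_vec w \<bullet> a \<tau> + b \<tau>"
    "\<And>\<tau> w. \<tau> \<in> facets T \<Longrightarrow> w \<in> A \<Longrightarrow> \<not> lattice_vec w extreme_point_of \<tau> \<Longrightarrow>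
       lattice_vec w \<bullet> a \<tau> + b \<tau> < H w"
    "inj_on a (facets T)"
proof -
  obtain h where conv: "convex_on (convex hull (lattice_vec ` A)) h"
    and affine': "\<forall>S\<in>T. affine_fun_on S h"
    and separate': "\<forall>\<sigma>\<in>facets T. \<forall>\<tau>\<in>facets T. \<sigma> \<noteq> \<tau> \<longrightarrow> \<not> affine_fun_on (\<sigma> \<union> \<tau>) h"
    using assms by (auto simp only: regular_triangulation_of_def)
  note affine = affine'[rule_format] and separate = separate'[rule_format]
  have complex: "simplicial_complex T" and union: "\<Union>T = convex hull (lattice_vec ` A)"
    using assms by (simp_all only: regular_triangulation_of_def triangulation_of_def)
  have fin: "finite T" and simp': "\<forall>S\<in>T. \<exists>n. n simplex S"
    and faces': "\<forall>F S. S \<in> T \<and> F face_of S \<longrightarrow> F \<in> T"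
    and meet': "\<forall>S S'. S \<in> T \<and> S' \<in> T \<longrightarrow> (S \<inter> S') face_of S"
    using complex unfolding simplicial_complex_def by - (elim conjE, assumption)+
  note simp = simp'[rule_format] and faces = faces'[rule_format, OF conjI] and meet = meet'[rule_format, OF conjI]
  have facetT: "\<tau> \<in> T" if "\<tau> \<in> facets T" for \<tau>
    using that by (simp add: facets_def)
  have int: "interior \<tau> \<noteq> {}" if "\<tau> \<in> facets T" for \<tau>
    using facet_cases[OF that] by blast
  have "\<exists>a b. \<forall>x\<in>\<tau>. h x = a \<bullet> x + b" if "\<tau> \<in> facets T" for \<tau>
    using affine[OF facetT[OF that]] unfolding affine_fun_on_def .
  then obtain a b where ab: "\<And>\<tau> x. \<tau> \<in> facets T \<Longrightarrow> x \<in> \<tau> \<Longrightarrow> h x = a \<tau> \<bullet> x + b \<tau>"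
    by metis
  \<comment> \<open>The singleton test asks whether the point is a vertex of the triangulation; the
    increment 1 stands for an arbitrary positive amount.\<close>
  define H where "H w = (if {lattice_vec w} \<in> T then h (lattice_vec w) else h (lattice_vec w) + 1)"
    for w :: "int^'d"
  have conv': "convex_on (\<Union>T) h"
    using conv union by simp
  show ?thesis
  proof (rule that[of H a b])
    fix \<tau> w assume \<tau>: "\<tau> \<in> facets T" and w: "lattice_vec w extreme_point_of \<tau>"
    have "{lattice_vec w} \<in> T"
      using faces[OF facetT[OF \<tau>]] w by (simp add: face_of_singleton)
    moreover have "lattice_vec w \<in> \<tau>"
      using w by (simp add: extreme_point_of_def)
    ultimately show "H w = lattice_vec w \<bullet> a \<tau> + b \<tau>"
      using ab[OF \<tau>] by (simp add: H_def inner_commute)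
  next
    fix \<tau> w assume \<tau>: "\<tau> \<in> facets T" and w: "w \<in> A" and nw: "\<not> lattice_vec w extreme_point_of \<tau>"
    show "lattice_vec w \<bullet> a \<tau> + b \<tau> < H w"
    proof (cases "lattice_vec w \<in> \<tau>")
      case True
      \<comment> \<open>Simplices of \<open>T\<close> meet in common faces, so a vertex of
        \<open>T\<close> lying in \<tau> would be an extreme point of \<tau>.\<close>
      have "{lattice_vec w} \<notin> T"
      proof
        assume "{lattice_vec w} \<in> T"
        then have "\<tau> \<inter> {lattice_vec w} face_of \<tau>"
          using meet facetT[OF \<tau>] by blast
        then show False
          using True nw by (simp add: face_of_singleton)
      qed
      then show ?thesis
        using ab[OF \<tau> True] by (simp add: H_def inner_commute)
    next
      case False
      have "lattice_vec w \<in> \<Union>T"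
        unfolding union using w by (simp add: hull_inc)
      then have "a \<tau> \<bullet> lattice_vec w + b \<tau> < h (lattice_vec w)"
        using False
        by (intro regular_facet_strict[OF fin simp conv' affine _ facetT[OF \<tau>] int[OF \<tau>] ab[OF \<tau>]]
            separate[OF \<tau>]) auto
      then show ?thesis
        by (simp add: H_def inner_commute)
    qed
  next
    show "inj_on a (facets T)"
    proof (rule inj_onI, rule ccontr)
      fix \<sigma> \<tau> assume *: "\<sigma> \<in> facets T" "\<tau> \<in> facets T" "a \<sigma> = a \<tau>" "\<sigma> \<noteq> \<tau>"
      \<comment> \<open>For equal slopes, the supporting inequality of one facet at a point of the
        other compares the intercepts. By symmetry they agree, and one affine function would serve
        both facets.\<close>
      have le: "b \<mu> \<le> b \<nu>" if \<mu>\<nu>: "\<mu> \<in> facets T" "\<nu> \<in> facets T" "a \<mu> = a \<nu>" for \<mu> \<nu>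
      proof -
        obtain p where p: "p \<in> \<nu>"
          using int[OF \<mu>\<nu>(2)] interior_subset by blast
        have "a \<mu> \<bullet> p + b \<mu> \<le> h p"
          by (rule convex_on_ge_affine_extension[OF conv' _ int[OF \<mu>\<nu>(1)] ab[OF \<mu>\<nu>(1)]])
            (use facetT \<mu>\<nu> p in auto)
        then show ?thesis
          using ab[OF \<mu>\<nu>(2) p] \<mu>\<nu>(3) by simp
      qed
      have "b \<sigma> = b \<tau>"
        using le[OF *(1,2,3)] le[OF *(2,1) *(3)[symmetric]] by (rule order_antisym)
      then have "affine_fun_on (\<sigma> \<union> \<tau>) h"
        using ab[OF *(1)] ab[OF *(2)] *(3) unfolding affine_fun_on_def
        by (intro exI[of _ "a \<sigma>"] exI[of _ "b \<sigma>"]) auto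
      then show False
        using separate * by blast
    qed
  qed
qed

section \<open>Laurent systems in logarithmic coordinates\<close>

lemma inj_lattice_vec: "inj lattice_vec"
  by (auto simp: inj_def lattice_vec_def vec_eq_iff)

text \<open>The cut-off outside \<open>A\<close> gives finite support when \<open>A\<close> is
  finite, which \<open>Abs_poly_mapping\<close> needs in order to return the intended
  coefficients.\<close>

definition rescaled_system :: "(int^'d) set \<Rightarrow> (int^'d \<Rightarrow> real) \<Rightarrow> (int^'d \<Rightarrow> real^'d) \<Rightarrow> 'd laurent_system"
  where "rescaled_system A s \<phi> =
    (\<chi> j. Abs_poly_mapping (\<lambda>w. if w \<in> A then s w * \<phi> w $ j else 0))"

lemma lookup_rescaled_system:
  assumes "finite A"
  shows "Poly_Mapping.lookup (rescaled_system A s \<phi> $ j) w = (if w \<in> A then s w * \<phi> w $ j else 0)"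
proof -
  have "finite {w. (if w \<in> A then s w * \<phi> w $ j else 0) \<noteq> 0}"
    by (rule finite_subset[OF _ assms]) auto
  then show ?thesis
    by (simp add: rescaled_system_def lookup_Abs_poly_mapping)
qed

lemma keys_rescaled_system:
  assumes "finite A"
  shows "Poly_Mapping.keys (rescaled_system A s \<phi> $ j) \<subseteq> A"
  using lookup_rescaled_system[OF assms] by (metis in_keys_iff subsetI)

lemma monomial_eq_exp:
  fixes x :: "real^'d"
  assumes "\<And>i. x $ i > 0"
  shows "(\<Prod>i\<in>UNIV. (x $ i) powi (w $ i)) = exp (lattice_vec w \<bullet> (\<chi> i. ln (x $ i)))"
proof -
  have "(x $ i) powi (w $ i) = exp (real_of_int (w $ i) * ln (x $ i))" for i
    using exp_power_int[of "ln (x $ i)" "w $ i"] assms by simp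
  then show ?thesis
    by (simp add: inner_vec_def lattice_vec_def exp_sum)
qed

lemma system_eval_rescaled:
  fixes x :: "real^'d"
  assumes "finite A" and "\<And>i. x $ i > 0"
  shows "system_eval (rescaled_system A s \<phi>) x = exponential_sum A s lattice_vec \<phi> (\<chi> i. ln (x $ i))"
proof -
  have "laurent_eval (rescaled_system A s \<phi> $ j) x =
      (\<Sum>w\<in>A. s w * \<phi> w $ j * exp (lattice_vec w \<bullet> (\<chi> i. ln (x $ i))))" for j
    unfolding laurent_eval_def
    by (rule sum.mono_neutral_cong_left[OF assms(1) keys_rescaled_system[OF assms(1)]])
      (auto simp: in_keys_iff lookup_rescaled_system[OF assms(1)] monomial_eq_exp[OF assms(2)])
  then show ?thesis
    by (simp add: system_eval_def exponential_sum_def vec_eq_iff mult_ac)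
qed

text \<open>The coordinatewise logarithm has an invertible diagonal derivative on the positive
  orthant, so by the chain rule non-degeneracy carries over from \<open>z\<close> to its
  exponential.\<close>

lemma nondegenerate_positive_solution_exp:
  fixes z :: "real^'d"
  assumes "finite A" and zero: "exponential_sum A s lattice_vec \<phi> z = 0"
    and inj: "inj (exponential_sum_deriv A s lattice_vec \<phi> z)"
  shows "(\<chi> i. exp (z $ i)) \<in> nondegenerate_positive_solutions (rescaled_system A s \<phi>)"
proof -
  let ?x = "(\<chi> i. exp (z $ i)) :: real^'d"
  let ?ln = "\<lambda>x::real^'d. (\<chi> i. ln (x $ i)) :: real^'d"
  let ?F = "system_eval (rescaled_system A s \<phi>)"
  \<comment> \<open>This is the derivative of the logarithm at \<open>?x\<close>, whose diagonal
    entries are the reciprocals of the coordinates \<open>exp (z $ i)\<close>.\<close>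
  define D where "D v = (\<chi> i. exp (- z $ i) * v $ i)" for v :: "real^'d"
  have lnx: "?ln ?x = z"
    by (simp add: vec_eq_iff)
  have "(?ln has_derivative D) (at ?x)"
  proof (subst has_derivative_componentwise_within, intro ballI)
    fix b :: "real^'d" assume "b \<in> Basis"
    then obtain k where b: "b = axis k 1"
      by (auto simp: Basis_vec_def)
    have "((\<lambda>x::real^'d. ln (x $ k)) has_derivative (\<lambda>v. exp (- z $ k) * v $ k)) (at ?x)"
      by (auto intro!: derivative_eq_intros bounded_linear_imp_has_derivative bounded_linear_vec_nth
          simp: exp_minus divide_inverse fun_eq_iff)
    then show "((\<lambda>x. ?ln x \<bullet> b) has_derivative (\<lambda>v. D v \<bullet> b)) (at ?x)"
      by (simp add: b inner_axis D_def)
  qed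
  then have "((exponential_sum A s lattice_vec \<phi> \<circ> ?ln) has_derivative
      (exponential_sum_deriv A s lattice_vec \<phi> z \<circ> D)) (at ?x)"
    using diff_chain_at exponential_sum_has_derivative[of A s lattice_vec \<phi> z UNIV] lnx by metis
  \<comment> \<open>The two maps are known to agree only at positive points, but these form a
    neighbourhood of \<open>?x\<close>.\<close>
  moreover have "\<forall>\<^sub>F x in at ?x. (exponential_sum A s lattice_vec \<phi> \<circ> ?ln) x = ?F x"
  proof -
    have "\<forall>\<^sub>F x in nhds ?x. x $ i > 0" for i
      by (rule eventually_nhds_in_open[of "{x. x $ i > 0}", THEN eventually_mono])
        (auto intro: open_halfspace_component_gt_cart)
    then have "\<forall>\<^sub>F x in nhds ?x. \<forall>i. x $ i > 0"
      by (simp add: eventually_all_finite)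
    then have "\<forall>\<^sub>F x in at ?x. \<forall>i. x $ i > 0"
      by (simp add: eventually_nhds_conv_at)
    then show ?thesis
      by eventually_elim (simp add: system_eval_rescaled[OF assms(1)])
  qed
  ultimately have der: "(?F has_derivative (exponential_sum_deriv A s lattice_vec \<phi> z \<circ> D)) (at ?x)"
    by (rule has_derivative_transform_eventually)
      (auto simp: system_eval_rescaled[OF assms(1)])
  have "inj D"
    by (auto simp: inj_def D_def vec_eq_iff)
  moreover have "(*v) (jacobian ?F (at ?x)) = exponential_sum_deriv A s lattice_vec \<phi> z \<circ> D"
    using der has_derivative_unique jacobian_works differentiableI by blast
  ultimately have "inj ((*v) (jacobian ?F (at ?x)))"
    using inj by (simp add: inj_compose)
  then have "invertible (jacobian ?F (at ?x))"
    using invertible_left_inverse matrix_left_invertible_injective by blast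
  then show ?thesis
    using zero system_eval_rescaled[OF assms(1), of ?x s \<phi>] lnx
    by (simp add: nondegenerate_positive_solutions_def)
qed

section \<open>Gluing the facets\<close>

lemma tendsto_exp_neg_mult:
  assumes "k > (0::real)"
  shows "((\<lambda>s. exp (- s * k)) \<longlongrightarrow> 0) at_top"
proof -
  have "filterlim (\<lambda>s. k * s) at_top at_top"
    by (rule filterlim_tendsto_pos_mult_at_top[OF tendsto_const assms filterlim_ident])
  then have "((\<lambda>s. exp (- (k * s))) \<longlongrightarrow> 0) at_top"
    by (intro filterlim_compose[OF exp_at_bot]) (simp add: filterlim_uminus_at_bot)
  then show ?thesis
    by (simp add: mult.commute)
qed

theorem theorem1:
  fixes A :: "(int^'d) set"
    and \<Gamma> :: "(real^'d) set set"
    and \<phi> :: "int^'d \<Rightarrow> real^'d"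
  assumes "finite A"
    and "regular_full_dim_pure_complex A \<Gamma>"
  shows "\<exists>F :: 'd laurent_system.
           supported_on F A \<and>
           coeffs_rescale F A \<phi> \<and>
           {\<tau> \<in> facets \<Gamma>. positively_decorated \<phi> \<tau>} \<lesssim> nondegenerate_positive_solutions F"
proof -
  obtain T where T: "regular_triangulation_of A T" and "\<Gamma> \<subseteq> T"
    using assms(2) unfolding regular_full_dim_pure_complex_def by blast
  have tri: "triangulation_of A T"
    using T by (simp add: regular_triangulation_of_def)
  define \<D> where "\<D> = {\<tau> \<in> facets \<Gamma>. positively_decorated \<phi> \<tau>}"
  have \<D>T: "\<D> \<subseteq> facets T"
    using \<open>\<Gamma> \<subseteq> T\<close> by (auto simp: \<D>_def facets_def)
  have "finite T"
    using tri by (simp add: triangulation_of_def simplicial_complex_def)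
  then have "finite \<D>"
    using \<D>T by (rule_tac finite_subset[of _ T]) (auto simp: facets_def)
  obtain H a b where H: "\<And>\<tau> w. \<tau> \<in> facets T \<Longrightarrow> lattice_vec w extreme_point_of \<tau> \<Longrightarrow>
        H w = lattice_vec w \<bullet> a \<tau> + b \<tau>"
    and Hless: "\<And>\<tau> w. \<tau> \<in> facets T \<Longrightarrow> w \<in> A \<Longrightarrow> \<not> lattice_vec w extreme_point_of \<tau> \<Longrightarrow>
        lattice_vec w \<bullet> a \<tau> + b \<tau> < H w"
    and inj_a: "inj_on a (facets T)"
    using regular_triangulation_heights[OF T] by blast
  define V where "V \<tau> = {w. lattice_vec w extreme_point_of \<tau>}" for \<tau> :: "(real^'d) set"
  \<comment> \<open>\<open>c\<close> holds the scalars seen from \<tau> after the shift by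
    \<open>s *\<^sub>R a \<tau>\<close>, up to a common factor. Its exponent measures the gap
    between the height and the affine function of \<tau>, zero at vertices and positive elsewhere on
    \<open>A\<close>; so \<open>c0\<close> is its limit.\<close>
  define c0 :: "(real^'d) set \<Rightarrow> int^'d \<Rightarrow> real" where "c0 \<tau> w = (if w \<in> V \<tau> then 1 else 0)" for \<tau> w
  define c where "c \<tau> s w = exp (- s * (H w - lattice_vec w \<bullet> a \<tau> - b \<tau>))" for \<tau> s w
  have "\<exists>u. exponential_sum A (c0 \<tau>) lattice_vec \<phi> u = 0 \<and> surj (exponential_sum_deriv A (c0 \<tau>) lattice_vec \<phi> u)"
    if "\<tau> \<in> \<D>" for \<tau>
  proof -
    have \<tau>: "\<tau> \<in> facets T"
      using that \<D>T by blast
    obtain C where C: "{v. v extreme_point_of \<tau>} = C" "\<not> affine_dependent C"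
      using facet_cases[OF \<tau>] by metis
    have "C \<subseteq> lattice_vec ` A"
      using tri \<tau> C unfolding triangulation_of_def facets_def by blast
    then have image: "lattice_vec ` V \<tau> = C"
      using C(1) unfolding V_def by blast
    have VA: "V \<tau> \<subseteq> A"
    proof
      fix w assume "w \<in> V \<tau>"
      then have "lattice_vec w \<in> lattice_vec ` A"
        using image \<open>C \<subseteq> lattice_vec ` A\<close> by blast
      then show "w \<in> A"
        by (simp only: inj_image_mem_iff[OF inj_lattice_vec])
    qed
    have indep: "\<not> affine_dependent (lattice_vec ` V \<tau>)"
      using C(2) image by simp
    have span: "\<exists>c. (\<forall>w\<in>V \<tau>. c w > 0) \<and> y = (\<Sum>w\<in>V \<tau>. c w *\<^sub>R \<phi> w)" for y
      using that by (simp add: \<D>_def positively_decorated_def positively_spans_def V_def)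
    obtain u where "exponential_sum (V \<tau>) (\<lambda>_. 1) lattice_vec \<phi> u = 0"
        "surj (exponential_sum_deriv (V \<tau>) (\<lambda>_. 1) lattice_vec \<phi> u)"
      by (rule exponential_sum_simplex_zero[OF indep inj_on_subset[OF inj_lattice_vec subset_UNIV] span])
    moreover have "exponential_sum A (c0 \<tau>) lattice_vec \<phi> u = exponential_sum (V \<tau>) (\<lambda>_. 1) lattice_vec \<phi> u"
      unfolding exponential_sum_def c0_def
      by (rule sum.mono_neutral_cong_right[OF assms(1) VA]) auto
    moreover have "exponential_sum_deriv A (c0 \<tau>) lattice_vec \<phi> u =
        exponential_sum_deriv (V \<tau>) (\<lambda>_. 1) lattice_vec \<phi> u"
      unfolding exponential_sum_deriv_def c0_def
      by (rule ext, rule sum.mono_neutral_cong_right[OF assms(1) VA]) auto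
    ultimately show ?thesis
      by auto
  qed
  then obtain u where u: "\<And>\<tau>. \<tau> \<in> \<D> \<Longrightarrow> exponential_sum A (c0 \<tau>) lattice_vec \<phi> (u \<tau>) = 0"
      "\<And>\<tau>. \<tau> \<in> \<D> \<Longrightarrow> surj (exponential_sum_deriv A (c0 \<tau>) lattice_vec \<phi> (u \<tau>))"
    by metis
  have lim: "((\<lambda>s. c \<tau> s w) \<longlongrightarrow> c0 \<tau> w) at_top" if "\<tau> \<in> \<D>" "w \<in> A" for \<tau> w
  proof (cases "w \<in> V \<tau>")
    case True
    then show ?thesis
      using H[of \<tau> w] that \<D>T by (auto simp: c_def c0_def V_def)
  next
    case False
    then have "0 < H w - lattice_vec w \<bullet> a \<tau> - b \<tau>"
      using Hless[of \<tau> w] that \<D>T by (auto simp: V_def)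
    then show ?thesis
      using False tendsto_exp_neg_mult by (simp add: c_def c0_def)
  qed
  have "\<forall>\<^sub>F s in at_top. \<forall>\<tau>\<in>\<D>. \<exists>v\<in>cball (u \<tau>) 1.
      exponential_sum A (c \<tau> s) lattice_vec \<phi> v = 0 \<and> inj (exponential_sum_deriv A (c \<tau> s) lattice_vec \<phi> v)"
    using \<open>finite \<D>\<close> exponential_sum_zero_persists[OF lim u zero_less_one]
    by (simp add: eventually_ball_finite)
  \<comment> \<open>The 2 is the sum of two radii, each zero lying within distance 1 of its centre.
    Distinct facets have distinct slopes, so the right-hand side grows without bound.\<close>
  moreover have "\<forall>\<^sub>F s in at_top. \<forall>\<tau>\<in>\<D>. \<forall>\<sigma>\<in>\<D>. \<tau> \<noteq> \<sigma> \<longrightarrow> norm (u \<sigma> - u \<tau>) + 2 < s * norm (a \<tau> - a \<sigma>)"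
  proof (intro eventually_ball_finite[OF \<open>finite \<D>\<close>] ballI)
    fix \<tau> \<sigma> assume *: "\<tau> \<in> \<D>" "\<sigma> \<in> \<D>"
    show "\<forall>\<^sub>F s in at_top. \<tau> \<noteq> \<sigma> \<longrightarrow> norm (u \<sigma> - u \<tau>) + 2 < s * norm (a \<tau> - a \<sigma>)"
    proof (cases "\<tau> = \<sigma>")
      case False
      then have pos: "norm (a \<tau> - a \<sigma>) > 0"
        using inj_a * \<D>T by (auto simp: inj_on_def)
      show ?thesis
        using eventually_gt_at_top[of "(norm (u \<sigma> - u \<tau>) + 2) / norm (a \<tau> - a \<sigma>)"]
        by eventually_elim (use pos in \<open>simp add: pos_divide_less_eq\<close>)
    qed simp
  qed
  ultimately have "\<forall>\<^sub>F s in at_top. (\<forall>\<tau>\<in>\<D>. \<exists>v\<in>cball (u \<tau>) 1.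
      exponential_sum A (c \<tau> s) lattice_vec \<phi> v = 0 \<and> inj (exponential_sum_deriv A (c \<tau> s) lattice_vec \<phi> v)) \<and>
      (\<forall>\<tau>\<in>\<D>. \<forall>\<sigma>\<in>\<D>. \<tau> \<noteq> \<sigma> \<longrightarrow> norm (u \<sigma> - u \<tau>) + 2 < s * norm (a \<tau> - a \<sigma>))"
    by (rule eventually_conj)
  from eventually_happens'[OF trivial_limit_at_top_linorder this]
  obtain s :: real where s: "\<forall>\<tau>\<in>\<D>. \<exists>v\<in>cball (u \<tau>) 1.
      exponential_sum A (c \<tau> s) lattice_vec \<phi> v = 0 \<and> inj (exponential_sum_deriv A (c \<tau> s) lattice_vec \<phi> v)"
    and far: "\<forall>\<tau>\<in>\<D>. \<forall>\<sigma>\<in>\<D>. \<tau> \<noteq> \<sigma> \<longrightarrow> norm (u \<sigma> - u \<tau>) + 2 < s * norm (a \<tau> - a \<sigma>)"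
    by (elim exE conjE)
  from bchoice[OF s[unfolded Bex_def]] obtain v where v: "\<And>\<tau>. \<tau> \<in> \<D> \<Longrightarrow> v \<tau> \<in> cball (u \<tau>) 1"
      "\<And>\<tau>. \<tau> \<in> \<D> \<Longrightarrow> exponential_sum A (c \<tau> s) lattice_vec \<phi> (v \<tau>) = 0"
      "\<And>\<tau>. \<tau> \<in> \<D> \<Longrightarrow> inj (exponential_sum_deriv A (c \<tau> s) lattice_vec \<phi> (v \<tau>))"
    by auto
  \<comment> \<open>Undoing the shift of each facet yields zeros of one and the same sum, whose
    scalars \<open>k\<close> do not involve \<tau>.\<close>
  define z where "z \<tau> = v \<tau> + s *\<^sub>R a \<tau>" for \<tau>
  define k where "k w = exp (- s * H w)" for w
  \<comment> \<open>The factor \<open>exp (- s * b \<tau>)\<close> is the same for all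
    \<open>w\<close> and nonzero, so zeros and injectivity of the derivative are preserved.\<close>
  have k: "(\<lambda>w. k w * exp (lattice_vec w \<bullet> (s *\<^sub>R a \<tau>))) = (\<lambda>w. exp (- s * b \<tau>) * c \<tau> s w)" for \<tau>
    by (simp add: k_def c_def exp_add[symmetric] algebra_simps)
  let ?F = "rescaled_system A k \<phi>"
  let ?X = "\<lambda>\<tau>. (\<chi> i. exp (z \<tau> $ i)) :: real^'d"
  have "?X \<tau> \<in> nondegenerate_positive_solutions ?F" if "\<tau> \<in> \<D>" for \<tau>
  proof (rule nondegenerate_positive_solution_exp[OF assms(1)])
    show "exponential_sum A k lattice_vec \<phi> (z \<tau>) = 0"
      by (simp only: z_def exponential_sum_add k exponential_sum_scale v(2)[OF that] scaleR_zero_right)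
    show "inj (exponential_sum_deriv A k lattice_vec \<phi> (z \<tau>))"
      using v(3)[OF that]
      by (simp only: z_def exponential_sum_deriv_add k inj_def exponential_sum_deriv_scale
          scaleR_cancel_left exp_not_eq_zero simp_thms)
  qed
  moreover have "inj_on ?X \<D>"
  proof (rule inj_onI, rule ccontr)
    fix \<tau> \<sigma> assume *: "\<tau> \<in> \<D>" "\<sigma> \<in> \<D>" "?X \<tau> = ?X \<sigma>" "\<tau> \<noteq> \<sigma>"
    then have "z \<tau> = z \<sigma>"
      by (simp add: vec_eq_iff)
    \<comment> \<open>Coinciding solutions would bound the scaled slope difference by the distance
      of the centres plus two unit radii, against \<open>far\<close>.\<close>
    then have "s *\<^sub>R (a \<tau> - a \<sigma>) = (v \<sigma> - u \<sigma>) + (u \<sigma> - u \<tau>) + (u \<tau> - v \<tau>)"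
      by (simp add: z_def algebra_simps)
    then have "norm (s *\<^sub>R (a \<tau> - a \<sigma>)) \<le> norm (v \<sigma> - u \<sigma>) + norm (u \<sigma> - u \<tau>) + norm (u \<tau> - v \<tau>)"
      using norm_triangle_ineq[of "(v \<sigma> - u \<sigma>) + (u \<sigma> - u \<tau>)" "u \<tau> - v \<tau>"]
        norm_triangle_ineq[of "v \<sigma> - u \<sigma>" "u \<sigma> - u \<tau>"] by (simp only:)
    also have "\<dots> \<le> norm (u \<sigma> - u \<tau>) + 2"
      using v(1)[OF *(1)] v(1)[OF *(2)] by (simp add: dist_norm norm_minus_commute)
    also have "\<dots> < s * norm (a \<tau> - a \<sigma>)"
      using far * by blast
    also have "\<dots> \<le> norm (s *\<^sub>R (a \<tau> - a \<sigma>))"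
      by (simp add: mult_right_mono)
    finally show False
      by simp
  qed
  ultimately have "\<D> \<lesssim> nondegenerate_positive_solutions ?F"
    unfolding lepoll_def by blast
  moreover have "supported_on ?F A"
    using keys_rescaled_system[OF assms(1)] by (simp add: supported_on_def)
  moreover have "coeffs_rescale ?F A \<phi>"
    unfolding coeffs_rescale_def
  proof
    fix w assume "w \<in> A"
    then have "coeff_vec ?F w = k w *\<^sub>R \<phi> w"
      by (simp add: coeff_vec_def lookup_rescaled_system[OF assms(1)] vec_eq_iff)
    moreover have "k w > 0"
      by (simp add: k_def)
    ultimately show "\<exists>s>0. coeff_vec ?F w = s *\<^sub>R \<phi> w"
      by blast
  qed
  ultimately show ?thesis
    unfolding \<D>_def by blast
qed

end
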